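(* Let $F:U\to Y$ be completely continuous, i.e., $u_n\rightharpoonup u$ weakly in $U$ implies $F(u_n)\to F(u)$ strongly in $Y$. Assume that there are constants $L>0$, $\rho_0>0$ with $\|G_u\|_{\mathbb{L}(U,Y)}\le L$ for all $u\in\overline B_U(u^\dag,\rho_0)$; that there are constants $\rho\in(0,\rho_0]$ and $\mu\in[0,1)$ with $$\|F(\hat u)-F(u)-G_u(\hat u-u)\|_Y\le\mu\|F(\hat u)-F(u)\|_Y\quad\text{for all }u,\hat u\in\overline B_U(u^\dag,\rho);$$ and that there are a Banach space $Z\subset U$, compactly embedded in $U$, with $\bigcup_{u\in U}\mathcal R(G_u^* )\subset Z$, and a constant $\hat L>0$ with $\|G_u^*\|_{\mathbb{L}(Y,Z)}\le\hat L$ for all $u\in\overline B_U(u^\dag,\rho)$. Let $\tau>1$ and $\Lambda\ge\lambda>0$ satisfy $$\frac{2(\mu+1)}{\tau}-(2-2\mu-\Lambda L^2)<0\qquad\text{and}\qquad -1+\mu+5\Lambda L^2<0.$$ Then for any starting point $u_0\in\overline B_U(u^\dag,\rho)$ and any step sizes $\{w_n\}_{n\in\mathbb N}\subset[\lambda,\Lambda]$, the modified Landweber iteration stopped according to the discrepancy principle with constant $\tau$ is asymptotically stable.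
   Context: $U,Y$ are real Hilbert spaces, $F:U\to Y$ is a mapping, $u^\dag\in U$ and $y^\dag=F(u^\dag)$. $\overline B_U(u,\rho)$ is the closed ball in $U$ of radius $\rho$ centered at $u$, and $S(u^\dag,\rho):=\{u\in\overline B_U(u^\dag,\rho):F(u)=y^\dag\}$. $\mathbb{L}(X,Y)$ is the space of bounded linear operators. $u\mapsto G_u\in\mathbb{L}(U,Y)$ is a given mapping on $U$ (not assumed continuous), $G_u^*\in\mathbb{L}(Y,U)$ is the Hilbert space adjoint of $G_u$, and $\mathcal R(\cdot)$ denotes the range. Modified Landweber iteration: for $\delta>0$ and $y^\delta\in Y$ with $\|y^\delta-y^\dag\|_Y\le\delta$, set $u_0^\delta:=u_0$ and $u_{n+1}^\delta=u_n^\delta+w_nG_{u_n^\delta}^*(y^\delta-F(u_n^\delta))$, $n\ge0$, with step sizes $w_n>0$ (independent of $\delta$). Discrepancy principle: for a constant $\tau>1$, the stopping index $N_\delta=N(\delta,y^\delta)$ is defined by $\|y^\delta-F(u^\delta_{N_\delta})\|_Y\le\tau\delta<\|y^\delta-F(u_n^\delta)\|_Y$ for $0\le n<N_\delta$. Asymptotic stability: the iterative method producing $\{u_n^\delta\}_{n\le N_\delta}$ is called asymptotically stable if any sequence $\{\delta_k\}_{k\in\mathbb N}$ of positive numbers converging to $0$ (with corresponding noisy data $y^{\delta_k}$, $\|y^{\delta_k}-y^\dag\|_Y\le\delta_k$) has a subsequence $\{\delta_{k_i}\}_{i\in\mathbb N}$ such that $\overline N:=\lim_{i\to\infty}N_{\delta_{k_i}}\in\mathbb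 N\cup\{\infty\}$ exists and: (i) for all $0\le n\le\overline N$ (with $n<\overline N$ if $\overline N=\infty$), $u_n^{\delta_{k_i}}\to\tilde u_n$ in $U$ as $i\to\infty$ for some $\tilde u_n\in\overline B_U(u^\dag,\rho)$; (ii) if $\overline N=\infty$, there exists $\tilde u\in S(u^\dag,\rho)$ such that $\tilde u_n\to\tilde u$ in $U$ as $n\to\infty$. *)

theory Defs
  imports "HOL-Analysis.Analysis"
begin

text \<open>Real Hilbert spaces are types of sort \<open>{real_inner, complete_space}\<close>; on such types
  \<^const>\<open>adjoint\<close> applied to a bounded linear operator is its Hilbert space adjoint.\<close>

definition weakly_tendsto :: "(nat \<Rightarrow> 'a::real_normed_vector) \<Rightarrow> 'a \<Rightarrow> bool" where
  "weakly_tendsto x a \<longleftrightarrow>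
     (\<forall>\<phi> :: 'a \<Rightarrow>\<^sub>L real. (\<lambda>n. blinfun_apply \<phi> (x n)) \<longlonglongrightarrow> blinfun_apply \<phi> a)"

definition completely_continuous ::
    "('a::real_normed_vector \<Rightarrow> 'b::real_normed_vector) \<Rightarrow> bool" where
  "completely_continuous F \<longleftrightarrow> (\<forall>x a. weakly_tendsto x a \<longrightarrow> (\<lambda>n. F (x n)) \<longlonglongrightarrow> F a)"

definition compact_embedding ::
    "('z::real_normed_vector \<Rightarrow> 'u::real_normed_vector) \<Rightarrow> bool" where
  "compact_embedding \<iota> \<longleftrightarrow>
     bounded_linear \<iota> \<and> inj \<iota> \<and> (\<forall>B. bounded B \<longrightarrow> compact (closure (\<iota> ` B)))"

definition solution_set ::
    "('u::metric_space \<Rightarrow> 'y) \<Rightarrow> 'u \<Rightarrow> real \<Rightarrow> 'u set" where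
  "solution_set F u\<^sub>d \<rho> = {u \<in> cball u\<^sub>d \<rho>. F u = F u\<^sub>d}"

primrec landweber ::
    "('u::real_inner \<Rightarrow> 'y::real_inner) \<Rightarrow> ('u \<Rightarrow> 'u \<Rightarrow>\<^sub>L 'y) \<Rightarrow> (nat \<Rightarrow> real) \<Rightarrow> 'u \<Rightarrow> 'y \<Rightarrow> nat \<Rightarrow> 'u"
where
  "landweber F G w u\<^sub>0 y 0 = u\<^sub>0"
| "landweber F G w u\<^sub>0 y (Suc n) =
     landweber F G w u\<^sub>0 y n
     + w n *\<^sub>R adjoint (blinfun_apply (G (landweber F G w u\<^sub>0 y n)))
                 (y - F (landweber F G w u\<^sub>0 y n))"

definition discrepancy_index ::
    "('u \<Rightarrow> 'y::real_normed_vector) \<Rightarrow> ('y \<Rightarrow> nat \<Rightarrow> 'u) \<Rightarrow> real \<Rightarrow> real \<Rightarrow> 'y \<Rightarrow> nat \<Rightarrow> bool"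
where
  "discrepancy_index F it \<tau> \<delta> y N \<longleftrightarrow>
     norm (y - F (it y N)) \<le> \<tau> * \<delta> \<and> (\<forall>n<N. \<tau> * \<delta> < norm (y - F (it y n)))"

text \<open>\<open>it y n\<close> is the \<open>n\<close>-th iterate for data \<open>y\<close>, and \<open>stop \<delta> y N\<close> says that \<open>N\<close> is
  the stopping index for noise level \<open>\<delta>\<close> and data \<open>y\<close>. A stopping rule determines at most one
  index; its existence for all noisy data, which is presupposed when one writes
  \<open>N(\<delta>, y)\<close>, is part of the property. The limit of the stopping indices is taken in the order
  topology of \<^typ>\<open>enat\<close>. Only iterates with \<open>n \<le> N k\<close> belong to the method; those beyond the
  stopping index do not affect the limits, since \<open>n \<le> Nbar\<close> implies
  \<open>n \<le> N (s i)\<close> for all large \<open>i\<close>.\<close>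

definition asymptotically_stable ::
    "('u::real_normed_vector \<Rightarrow> 'y::real_normed_vector) \<Rightarrow> 'u \<Rightarrow> real \<Rightarrow>
     ('y \<Rightarrow> nat \<Rightarrow> 'u) \<Rightarrow> (real \<Rightarrow> 'y \<Rightarrow> nat \<Rightarrow> bool) \<Rightarrow> bool"
where
  "asymptotically_stable F u\<^sub>d \<rho> it stop \<longleftrightarrow>
     (\<forall>(\<delta> :: nat \<Rightarrow> real) (y :: nat \<Rightarrow> 'y).
        (\<forall>k. 0 < \<delta> k) \<longrightarrow> \<delta> \<longlonglongrightarrow> 0 \<longrightarrow> (\<forall>k. norm (y k - F u\<^sub>d) \<le> \<delta> k) \<longrightarrow>
        (\<exists>N :: nat \<Rightarrow> nat. (\<forall>k. stop (\<delta> k) (y k) (N k)) \<and>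
          (\<exists>(s :: nat \<Rightarrow> nat) (Nbar :: enat) (ut :: nat \<Rightarrow> 'u).
             strict_mono s \<and>
             (\<lambda>i. enat (N (s i))) \<longlonglongrightarrow> Nbar \<and>
             (\<forall>n. enat n \<le> Nbar \<longrightarrow>
                ut n \<in> cball u\<^sub>d \<rho> \<and> (\<lambda>i. it (y (s i)) n) \<longlonglongrightarrow> ut n) \<and>
             (Nbar = \<infinity> \<longrightarrow> (\<exists>u\<in>solution_set F u\<^sub>d \<rho>. ut \<longlonglongrightarrow> u)))))"

end

theory Submission
  imports Defs
begin

text \<open>As long as the residual exceeds \<open>\<tau> * \<delta>\<close>, a step of the iteration decreases the squared
  error by at least a fixed multiple of the squared residual (\<open>step_decrease\<close>). Hence the
  iterates stay in the ball, and the stopping index exists.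

  Every increment up to stopping lies in the image under the compact embedding of a bounded set in \<open>'z\<close>, the bound
  being uniform in the noise level because \<open>F\<close> is Lipschitz on the ball by the cone condition.
  For each fixed \<open>n\<close> the \<open>n\<close>-th iterates for the various data therefore lie in one compact set,
  and a common subsequence converges for every \<open>n\<close>, along which the stopping indices converge
  in \<^typ>\<open>enat\<close> as well.

  If the stopping indices tend to infinity, the limits \<open>ut n\<close> need not satisfy
  the recursion for exact data, since \<open>G\<close> may be discontinuous. The classical convergence proof for
  exact data uses only two inequalities, however: the decrease of the squared error, and the
  estimate of the inner product of an increment with the error at another iterate
  (\<open>increment_inner_le\<close>). Neither contains \<open>G\<close> applied to a limit point, so both pass to the
  limit along the subsequence. \<open>convergent_of_monotone_decrease\<close> derives the convergence of \<open>ut\<close>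
  from them. Along \<open>ut\<close> the decrements of the squared error tend to zero, and so do the
  residuals, so that the limit is a solution.\<close>

section \<open>Adjoints on Hilbert spaces\<close>

text \<open>The representing vector is the minimiser of the quadratic functional
  \<open>x \<mapsto> x \<bullet> x - 2 * \<phi> x\<close>: by the parallelogram law every minimising sequence is Cauchy, and the
  Euler equation of the minimisation problem is the asserted identity.\<close>

lemma riesz_representation:
  fixes \<phi> :: "'a::{real_inner, complete_space} \<Rightarrow> real"
  assumes "bounded_linear \<phi>"
  shows "\<exists>a. \<forall>x. \<phi> x = x \<bullet> a"
proof -
  interpret \<phi>: bounded_linear \<phi> by fact
  define J where "J x = x \<bullet> x - 2 * \<phi> x" for x
  obtain K where K: "\<And>x. norm (\<phi> x) \<le> norm x * K" using \<phi>.bounded by blast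
  have J_lower: "- K\<^sup>2 \<le> J x" for x
  proof -
    have "\<phi> x \<le> norm x * K" using K[of x] by simp
    moreover have "0 \<le> (norm x - K)\<^sup>2" by simp
    ultimately show ?thesis
      by (simp add: J_def power2_diff power2_norm_eq_inner)
  qed
  define m where "m = Inf (range J)"
  have bdd: "bdd_below (range J)" using J_lower by (auto intro!: bdd_belowI)
  have m_le: "m \<le> J x" for x unfolding m_def using bdd by (simp add: cINF_lower)
  have "\<exists>x. J x < m + inverse (real (Suc n))" for n
    using cInf_lessD[of "range J" "m + inverse (real (Suc n))"] by (auto simp: m_def)
  then obtain X where X: "\<And>n. J (X n) < m + inverse (real (Suc n))" by metis
  have parallelogram: "(norm (x - y))\<^sup>2 = 2 * J x + 2 * J y - 4 * J ((1/2) *\<^sub>R (x + y))" for x y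
    by (simp add: J_def power2_norm_eq_inner inner_diff inner_add \<phi>.scaleR \<phi>.add inner_commute
        add_divide_distrib diff_divide_distrib)
  have "Cauchy X"
  proof (rule metric_CauchyI)
    fix e :: real assume "0 < e"
    then have "0 < e\<^sup>2 / 4" by simp
    then obtain M where M: "inverse (real (Suc M)) < e\<^sup>2 / 4"
      using reals_Archimedean by blast
    have "dist (X j) (X k) < e" if "M \<le> j" "M \<le> k" for j k
    proof -
      have "inverse (real (Suc j)) \<le> inverse (real (Suc M))"
        "inverse (real (Suc k)) \<le> inverse (real (Suc M))" using that by auto
      with X[of j] X[of k] m_le[of "(1/2) *\<^sub>R (X j + X k)"] M
      have "(norm (X j - X k))\<^sup>2 < e\<^sup>2" unfolding parallelogram by linarith
      then show ?thesis using \<open>0 < e\<close> by (simp add: dist_norm power2_less_imp_less)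
    qed
    then show "\<exists>M. \<forall>j\<ge>M. \<forall>k\<ge>M. dist (X j) (X k) < e" by blast
  qed
  then obtain a where a: "X \<longlonglongrightarrow> a" using Cauchy_convergent convergent_def by blast
  have "(\<lambda>n. J (X n)) \<longlonglongrightarrow> J a"
    unfolding J_def by (intro tendsto_intros a \<phi>.tendsto)
  moreover have "(\<lambda>n. m + inverse (real (Suc n))) \<longlonglongrightarrow> m + 0"
    by (intro tendsto_add tendsto_const LIMSEQ_inverse_real_of_nat)
  ultimately have "J a \<le> m"
    using X by (auto intro: LIMSEQ_le less_imp_le)
  have "\<phi> h = h \<bullet> a" for h
  proof -
    define d q where "d = h \<bullet> a - \<phi> h" and "q = h \<bullet> h"
    have "0 \<le> q" by (simp add: q_def)
    define t where "t = - d / (q + 1)"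
    have d_eq: "d = - (t * (q + 1))" using \<open>0 \<le> q\<close> by (simp add: t_def)
    have "0 \<le> J (a + t *\<^sub>R h) - J a" using m_le[of "a + t *\<^sub>R h"] \<open>J a \<le> m\<close> by linarith
    also have "\<dots> = 2 * t * d + t\<^sup>2 * q"
      by (simp add: J_def d_def q_def \<phi>.add \<phi>.scaleR inner_add inner_commute
          algebra_simps power2_eq_square)
    also have "\<dots> = - (t\<^sup>2 * (q + 2))"
      unfolding d_eq by (simp add: algebra_simps power2_eq_square)
    finally have "t\<^sup>2 * (q + 2) \<le> 0" by simp
    then have "d = 0" using \<open>0 \<le> q\<close> by (simp add: d_eq mult_le_0_iff)
    then show ?thesis by (simp add: d_def)
  qed
  then show ?thesis by blast
qed

lemma inner_adjoint:
  fixes f :: "'a::{real_inner, complete_space} \<Rightarrow> 'b::real_inner"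
  assumes "bounded_linear f"
  shows "f x \<bullet> y = x \<bullet> adjoint f y"
proof -
  have "\<forall>y. \<exists>a. \<forall>x. f x \<bullet> y = x \<bullet> a"
    using riesz_representation bounded_linear_inner_left_comp[OF assms] by blast
  then have "\<exists>f'. \<forall>x y. f x \<bullet> y = x \<bullet> f' y" by metis
  then show ?thesis unfolding adjoint_def by (rule someI2_ex) blast
qed

lemma norm_adjoint_le:
  fixes A :: "'a::{real_inner, complete_space} \<Rightarrow>\<^sub>L 'b::real_inner"
  shows "norm (adjoint (blinfun_apply A) y) \<le> norm A * norm y"
proof (cases "adjoint (blinfun_apply A) y = 0")
  case False
  let ?z = "adjoint (blinfun_apply A) y"
  have "norm ?z * norm ?z = blinfun_apply A ?z \<bullet> y"
    using inner_adjoint[OF blinfun.bounded_linear_right, of A ?z y]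
    by (simp flip: power2_eq_square power2_norm_eq_inner)
  also have "\<dots> \<le> norm (blinfun_apply A ?z) * norm y" by (rule norm_cauchy_schwarz)
  also have "\<dots> \<le> (norm A * norm ?z) * norm y" by (intro mult_right_mono norm_blinfun) simp
  finally have "norm ?z * norm ?z \<le> (norm A * norm y) * norm ?z" by (simp add: mult_ac)
  then show ?thesis using False by (simp add: mult_le_cancel_right)
qed simp

section \<open>Convergence criteria\<close>

text \<open>Tychonoff's theorem replaces a diagonal argument here: the product of the sets \<open>C n\<close> is
  compact in the space of sequences, whose product topology is metrisable.\<close>

lemma pointwise_convergent_subsequence:
  fixes v :: "nat \<Rightarrow> nat \<Rightarrow> 'a::metric_space"
  assumes "\<And>n. compact (C n)" and "\<And>k n. v k n \<in> C n"
  obtains s l where "strict_mono (s :: nat \<Rightarrow> nat)" and "\<And>n. (\<lambda>i. v (s i) n) \<longlonglongrightarrow> l n"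
proof -
  have "compactin (product_topology (\<lambda>_. euclidean) UNIV) (PiE UNIV C)"
    using assms(1) by (simp add: compactin_PiE)
  then have "compact (PiE UNIV C)" by (simp add: euclidean_product_topology)
  then have "seq_compact (PiE UNIV C)" by (rule compact_imp_seq_compact)
  moreover have "\<forall>k. v k \<in> PiE UNIV C" using assms(2) by (auto simp: PiE_iff)
  ultimately obtain l s where s: "strict_mono (s :: nat \<Rightarrow> nat)" "(v \<circ> s) \<longlonglongrightarrow> l"
    unfolding seq_compact_def by blast
  have "(\<lambda>i. v (s i) n) \<longlonglongrightarrow> l n" for n
    using continuous_on_tendsto_compose[OF continuous_on_product_coordinates[of n] s(2)]
    by simp
  with s(1) show thesis by (rule that)
qed

text \<open>The telescoping argument by which Hanke, Neubauer and Scherzer prove convergence of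
  the Landweber iteration for exact data. Two late iterates \<open>x m\<close> and \<open>x l\<close> are compared through
  an intermediate iterate \<open>x k\<close> with the smallest \<open>r\<close>. Then \<open>r k\<close> is dominated by each other \<open>r i\<close>,
  so the inner products sum to a multiple of \<open>\<Sum>i. (r i)\<^sup>2\<close>, which the first hypothesis bounds by
  the decrease of the squared distance to \<open>p\<close>.\<close>

lemma convergent_of_monotone_decrease:
  fixes x :: "nat \<Rightarrow> 'a::{real_inner, complete_space}"
  assumes decrease: "\<And>n. (norm (x (Suc n) - p))\<^sup>2 + c * (r n)\<^sup>2 \<le> (norm (x n - p))\<^sup>2"
    and almost_orthogonal:
      "\<And>i k. \<bar>(x (Suc i) - x i) \<bullet> (x k - p)\<bar> \<le> D * (r i * (r i + r k))"
    and r_nonneg: "\<And>n. 0 \<le> r n"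
    and "0 < c" "0 \<le> D"
  shows "convergent x"
proof -
  define a where "a n = (norm (x n - p))\<^sup>2" for n
  have step: "(r n)\<^sup>2 \<le> (a n - a (Suc n)) / c" for n
    using decrease[of n] \<open>0 < c\<close> by (simp add: a_def field_simps)
  have "a (Suc n) \<le> a n" for n
    using decrease[of n] \<open>0 < c\<close> by (smt (verit) a_def mult_nonneg_nonneg zero_le_power2)
  then have "decseq a" by (rule decseq_SucI)
  moreover have "0 \<le> a n" for n by (simp add: a_def)
  ultimately have "convergent a"
    by (metis decseq_convergent convergent_def)
  then have "Cauchy a" by (rule convergent_Cauchy)
  define E where "E = 2 * D / c"
  have "0 \<le> E" using \<open>0 < c\<close> \<open>0 \<le> D\<close> by (simp add: E_def)
  have inner_le: "\<bar>(x l - x m) \<bullet> (x k - p)\<bar> \<le> E * (a m - a l)"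
    if "m \<le> l" and small: "\<And>i. m \<le> i \<Longrightarrow> i < l \<Longrightarrow> r k \<le> r i" for m l k
    using that
  proof (induction l rule: dec_induct)
    case (step l)
    have "r l * (r l + r k) \<le> r l * (r l + r l)"
      using step.prems[of l] step.hyps r_nonneg by (intro mult_left_mono) auto
    then have "D * (r l * (r l + r k)) \<le> D * (2 * (r l)\<^sup>2)"
      using \<open>0 \<le> D\<close> by (intro mult_left_mono) (auto simp: power2_eq_square)
    also have "\<dots> \<le> D * (2 * ((a l - a (Suc l)) / c))"
      using \<open>0 \<le> D\<close> \<open>\<And>n. (r n)\<^sup>2 \<le> (a n - a (Suc n)) / c\<close> by (intro mult_left_mono) auto
    also have "\<dots> = E * (a l - a (Suc l))" by (simp add: E_def)
    finally have "\<bar>(x (Suc l) - x l) \<bullet> (x k - p)\<bar> \<le> E * (a l - a (Suc l))"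
      using almost_orthogonal[of l k] by linarith
    moreover have "\<bar>(x l - x m) \<bullet> (x k - p)\<bar> \<le> E * (a m - a l)"
      using step.IH step.prems by simp
    moreover have "x (Suc l) - x m = (x (Suc l) - x l) + (x l - x m)" by simp
    ultimately show ?case by (simp only: inner_add_left right_diff_distrib)
  qed simp
  have expand: "(norm (x j - x k))\<^sup>2 = a j - a k - 2 * ((x j - x k) \<bullet> (x k - p))" for j k
    by (simp add: a_def power2_norm_eq_inner inner_diff inner_commute algebra_simps)
  have close: "(norm (x l - x m))\<^sup>2 \<le> 4 * (1 + 2 * E) * (a m - a l)" if "m \<le> l" for m l
  proof -
    have "Min (r ` {m..l}) \<in> r ` {m..l}" using that by (intro Min_in) auto
    then obtain k where "k \<in> {m..l}" and "r k = Min (r ` {m..l})" by (metis imageE)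
    then have k: "m \<le> k" "k \<le> l" "\<And>i. m \<le> i \<Longrightarrow> i \<le> l \<Longrightarrow> r k \<le> r i" by auto
    (* ?M bounds both squared distances to x k: \<open>expand\<close> contributes at most a m - a l
       through the squared norms and twice E * (a m - a l) through the inner product. *)
    let ?M = "(1 + 2 * E) * (a m - a l)"
    have le: "a l \<le> a k" "a k \<le> a m" using \<open>decseq a\<close> k by (auto simp: decseq_def)
    have split_E: "E * (a m - a l) = E * (a m - a k) + E * (a k - a l)"
      by (simp add: algebra_simps)
    have nonneg: "0 \<le> E * (a m - a k)" "0 \<le> E * (a k - a l)"
      using \<open>0 \<le> E\<close> le by auto
    have M: "?M = (a m - a l) + 2 * (E * (a m - a l))" by (simp add: algebra_simps)
    have "(x m - x k) \<bullet> (x k - p) = - ((x k - x m) \<bullet> (x k - p))"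
      by (simp add: inner_diff_left)
    then have "(norm (x m - x k))\<^sup>2 \<le> ?M"
      using inner_le[of m k k] k le nonneg split_E M expand[of m k] by auto
    moreover have "(norm (x l - x k))\<^sup>2 \<le> ?M"
      using inner_le[of k l k] k le nonneg split_E M expand[of l k] by auto
    moreover have "(norm (x l - x m))\<^sup>2 \<le> 2 * (norm (x l - x k))\<^sup>2 + 2 * (norm (x m - x k))\<^sup>2"
    proof -
      have "0 \<le> (norm ((x l - x k) + (x m - x k)))\<^sup>2" by simp
      then show ?thesis by (simp add: power2_norm_eq_inner inner_diff inner_add inner_commute algebra_simps)
    qed
    ultimately show ?thesis by linarith
  qed
  have "Cauchy x"
  proof (rule metric_CauchyI)
    fix e :: real assume "0 < e"
    let ?M = "4 * (1 + 2 * E)"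
    have "0 < ?M" using \<open>0 \<le> E\<close> by simp
    then have "0 < e\<^sup>2 / ?M" using \<open>0 < e\<close> by simp
    then obtain n0 where n0: "\<And>m l. n0 \<le> m \<Longrightarrow> n0 \<le> l \<Longrightarrow> dist (a m) (a l) < e\<^sup>2 / ?M"
      using metric_CauchyD[OF \<open>Cauchy a\<close>] by blast
    have "dist (x l) (x m) < e" if "n0 \<le> m" "m \<le> l" for m l
    proof -
      have "a m - a l < e\<^sup>2 / ?M" using n0[of m l] that by (auto simp: dist_real_def)
      then have "?M * (a m - a l) < e\<^sup>2" using \<open>0 < ?M\<close> by (simp add: field_simps)
      then have "(norm (x l - x m))\<^sup>2 < e\<^sup>2" using close[OF that(2)] by linarith
      then show ?thesis using \<open>0 < e\<close> by (simp add: dist_norm power2_less_imp_less)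
    qed
    then show "\<exists>M. \<forall>m\<ge>M. \<forall>n\<ge>M. dist (x m) (x n) < e"
      by (metis dist_commute nle_le)
  qed
  then show ?thesis by (rule Cauchy_convergent)
qed


section \<open>The modified Landweber iteration\<close>

locale landweber_setting =
  fixes F :: "'u::{real_inner, complete_space} \<Rightarrow> 'y::{real_inner, complete_space}"
    and G :: "'u \<Rightarrow> 'u \<Rightarrow>\<^sub>L 'y"
    and u\<^sub>d u\<^sub>0 :: 'u
    and w :: "nat \<Rightarrow> real"
    and L \<rho> \<mu> \<tau> lam Lam :: real
  assumes L_pos: "0 < L"
    and G_bound: "\<And>u. u \<in> cball u\<^sub>d \<rho> \<Longrightarrow> norm (G u) \<le> L"
    and \<rho>_pos: "0 < \<rho>"
    and \<mu>_nonneg: "0 \<le> \<mu>" and \<mu>_less_1: "\<mu> < 1"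
    and tangential_cone: "\<And>u v. u \<in> cball u\<^sub>d \<rho> \<Longrightarrow> v \<in> cball u\<^sub>d \<rho> \<Longrightarrow>
           norm (F v - F u - blinfun_apply (G u) (v - u)) \<le> \<mu> * norm (F v - F u)"
    and \<tau>_pos: "0 < \<tau>"
    and lam_pos: "0 < lam"
    and gap: "2 * (\<mu> + 1) / \<tau> < 2 - 2 * \<mu> - Lam * L\<^sup>2"
    and start: "u\<^sub>0 \<in> cball u\<^sub>d \<rho>"
    and step_size: "\<And>n. w n \<in> {lam..Lam}"
begin

abbreviation B where "B \<equiv> cball u\<^sub>d \<rho>"

abbreviation it where "it \<equiv> landweber F G w u\<^sub>0"

text \<open>The factor of the squared residual in the guaranteed decrease of the squared error.\<close>

definition rate where
  "rate = lam * (2 - 2 * \<mu> - Lam * L\<^sup>2 - 2 * (\<mu> + 1) / \<tau>)"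

lemma rate_pos: "0 < rate"
  using gap lam_pos by (simp add: rate_def)

lemma Lam_pos: "0 < Lam"
  using step_size[of 0] lam_pos by auto

lemma center_in_ball: "u\<^sub>d \<in> B"
  using \<rho>_pos by simp

lemma norm_G_increment_le:
  assumes "u \<in> B" "v \<in> B"
  shows "norm (blinfun_apply (G u) (v - u)) \<le> (1 + \<mu>) * norm (F v - F u)"
proof -
  have "norm (blinfun_apply (G u) (v - u))
      \<le> norm (F v - F u) + norm (F v - F u - blinfun_apply (G u) (v - u))"
    using norm_triangle_sub[of "blinfun_apply (G u) (v - u)" "F v - F u"]
    by (simp only: norm_minus_commute)
  then show ?thesis using tangential_cone[OF assms] by (simp add: algebra_simps)
qed

lemma F_lipschitz:
  assumes "u \<in> B" "v \<in> B"
  shows "norm (F v - F u) \<le> L / (1 - \<mu>) * norm (v - u)"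
proof -
  have "norm (F v - F u) \<le> norm (blinfun_apply (G u) (v - u)) + \<mu> * norm (F v - F u)"
    using norm_triangle_sub[of "F v - F u" "blinfun_apply (G u) (v - u)"] tangential_cone[OF assms]
    by linarith
  moreover have "norm (blinfun_apply (G u) (v - u)) \<le> L * norm (v - u)"
    using norm_blinfun G_bound[OF assms(1)] by (meson mult_right_mono norm_ge_zero order_trans)
  ultimately have "(1 - \<mu>) * norm (F v - F u) \<le> L * norm (v - u)" by (simp add: algebra_simps)
  then show ?thesis using \<mu>_less_1 by (simp add: field_simps)
qed

lemma continuous_on_F: "continuous_on B F"
  using L_pos \<mu>_less_1 F_lipschitz
  by (intro lipschitz_on_continuous_on[of "L / (1 - \<mu>)"] lipschitz_onI) (auto simp: dist_norm)

text \<open>By the cone condition \<open>G u (u\<^sub>d - u)\<close> differs from the residual \<open>y - F u\<close> by at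
  most \<open>\<mu>\<close> times the residual plus \<open>1 + \<mu>\<close> times the data error. While the residual exceeds
  \<open>\<tau> * \<delta>\<close>, the data error is less than \<open>1 / \<tau>\<close> times the residual, and by \<open>gap\<close> the descent
  term dominates the quadratic term of the step.\<close>

lemma step_decrease:
  assumes u: "u \<in> B" and y: "norm (y - F u\<^sub>d) \<le> \<delta>" and res: "\<tau> * \<delta> < norm (y - F u)"
    and \<omega>: "\<omega> \<in> {lam..Lam}"
  shows "(norm (u + \<omega> *\<^sub>R adjoint (blinfun_apply (G u)) (y - F u) - u\<^sub>d))\<^sup>2
      + rate * (norm (y - F u))\<^sup>2 \<le> (norm (u - u\<^sub>d))\<^sup>2"
proof -
  define r R e g where "r = y - F u" and "R = norm r" and "e = u - u\<^sub>d"
    and "g = adjoint (blinfun_apply (G u)) r"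
  define \<xi> where "\<xi> = F u\<^sub>d - F u - blinfun_apply (G u) (u\<^sub>d - u)"
  have R_nonneg: "0 \<le> R" by (simp add: R_def)
  have \<omega>': "0 < \<omega>" "lam \<le> \<omega>" "\<omega> \<le> Lam" using \<omega> lam_pos by auto
  have \<delta>_le: "\<delta> \<le> R / \<tau>" using res \<tau>_pos by (simp add: R_def r_def field_simps)
  have "norm (F u\<^sub>d - F u) \<le> R + \<delta>"
    using norm_triangle_ineq4[of r "y - F u\<^sub>d"] y by (simp add: r_def R_def)
  then have \<xi>_le: "norm \<xi> \<le> \<mu> * (R + R / \<tau>)"
    using tangential_cone[OF u center_in_ball] \<mu>_nonneg \<delta>_le unfolding \<xi>_def
    by (smt (verit) mult_left_mono)
  have "blinfun_apply (G u) e = \<xi> + (y - F u\<^sub>d) - r"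
    by (simp add: \<xi>_def e_def r_def blinfun.diff_right)
  then have "e \<bullet> g = \<xi> \<bullet> r + (y - F u\<^sub>d) \<bullet> r - R\<^sup>2"
    using inner_adjoint[OF blinfun.bounded_linear_right, of "G u" e r]
    by (simp add: g_def inner_add_left inner_diff_left R_def power2_norm_eq_inner)
  also have "\<dots> \<le> (\<mu> * (R + R / \<tau>)) * R + (R / \<tau>) * R - R\<^sup>2"
  proof -
    have "\<xi> \<bullet> r \<le> (\<mu> * (R + R / \<tau>)) * R"
      using norm_cauchy_schwarz[of \<xi> r] mult_right_mono[OF \<xi>_le R_nonneg] by (simp add: R_def)
    moreover have "(y - F u\<^sub>d) \<bullet> r \<le> (R / \<tau>) * R"
      using norm_cauchy_schwarz[of "y - F u\<^sub>d" r] mult_right_mono[OF order_trans[OF y \<delta>_le] R_nonneg]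
      by (simp add: R_def)
    ultimately show ?thesis by linarith
  qed
  also have "\<dots> = R\<^sup>2 * ((1 + \<mu>) / \<tau> - (1 - \<mu>))"
    using \<tau>_pos by (simp add: field_simps power2_eq_square)
  finally have eg: "e \<bullet> g \<le> R\<^sup>2 * ((1 + \<mu>) / \<tau> - (1 - \<mu>))" .
  have "norm g \<le> L * R"
    using norm_adjoint_le[of "G u" r] mult_right_mono[OF G_bound[OF u] R_nonneg]
    by (simp add: g_def R_def)
  then have "(norm g)\<^sup>2 \<le> L\<^sup>2 * R\<^sup>2"
    using power_mono[of "norm g" "L * R" 2] by (simp add: power_mult_distrib)
  then have gg: "\<omega> * (norm g)\<^sup>2 \<le> Lam * (L\<^sup>2 * R\<^sup>2)"
    using \<omega>' by (intro mult_mono) auto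
  have "(norm (e + \<omega> *\<^sub>R g))\<^sup>2 = (norm e)\<^sup>2 + \<omega> * (2 * (e \<bullet> g) + \<omega> * (norm g)\<^sup>2)"
    by (simp add: power2_norm_eq_inner inner_add inner_commute algebra_simps)
  also have "\<dots> \<le> (norm e)\<^sup>2
      + \<omega> * (2 * (R\<^sup>2 * ((1 + \<mu>) / \<tau> - (1 - \<mu>))) + Lam * (L\<^sup>2 * R\<^sup>2))"
    using eg gg \<omega>' by (intro add_left_mono mult_left_mono add_mono) auto
  also have "\<dots> = (norm e)\<^sup>2 - \<omega> * ((2 - 2 * \<mu> - Lam * L\<^sup>2 - 2 * (\<mu> + 1) / \<tau>) * R\<^sup>2)"
    using \<tau>_pos by (simp add: field_simps)
  also have "\<dots> \<le> (norm e)\<^sup>2 - lam * ((2 - 2 * \<mu> - Lam * L\<^sup>2 - 2 * (\<mu> + 1) / \<tau>) * R\<^sup>2)"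
    using \<omega>' gap by (intro diff_left_mono mult_right_mono) auto
  finally have "(norm (e + \<omega> *\<^sub>R g))\<^sup>2 + rate * R\<^sup>2 \<le> (norm e)\<^sup>2"
    by (simp add: rate_def mult.assoc)
  moreover have "u + \<omega> *\<^sub>R g - u\<^sub>d = e + \<omega> *\<^sub>R g" by (simp add: e_def)
  ultimately have "(norm (u + \<omega> *\<^sub>R g - u\<^sub>d))\<^sup>2 + rate * R\<^sup>2 \<le> (norm e)\<^sup>2"
    by (simp only:)
  then show ?thesis by (simp only: e_def g_def R_def r_def)
qed

lemma iterate_in_ball:
  assumes y: "norm (y - F u\<^sub>d) \<le> \<delta>"
    and res: "\<And>n. n < N \<Longrightarrow> \<tau> * \<delta> < norm (y - F (it y n))"
    and "n \<le> N"
  shows "it y n \<in> B"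
  using \<open>n \<le> N\<close>
proof (induction n)
  case 0
  then show ?case using start by simp
next
  case (Suc n)
  then have "it y n \<in> B" by simp
  from step_decrease[OF this y res step_size, of n] Suc.prems rate_pos
  have "(norm (it y (Suc n) - u\<^sub>d))\<^sup>2 \<le> (norm (it y n - u\<^sub>d))\<^sup>2"
    by (smt (verit) Suc_le_lessD landweber.simps(2) mult_nonneg_nonneg zero_le_power2)
  then have "norm (it y (Suc n) - u\<^sub>d) \<le> norm (it y n - u\<^sub>d)"
    by (rule power2_le_imp_le) simp
  then show ?case using \<open>it y n \<in> B\<close> by (simp add: dist_norm norm_minus_commute del: landweber.simps)
qed

text \<open>Each step before stopping lowers the squared error by at least
  \<open>rate * (\<tau> * \<delta>)\<^sup>2\<close>, which can happen only finitely often.\<close>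

lemma discrepancy_index_exists:
  assumes y: "norm (y - F u\<^sub>d) \<le> \<delta>" and "0 < \<delta>"
  shows "\<exists>N. discrepancy_index F it \<tau> \<delta> y N"
proof -
  have "\<exists>n. norm (y - F (it y n)) \<le> \<tau> * \<delta>"
  proof (rule ccontr)
    assume "\<not> ?thesis"
    then have res: "\<tau> * \<delta> < norm (y - F (it y n))" for n by (auto simp: not_le)
    define q where "q = rate * (\<tau> * \<delta>)\<^sup>2"
    have "0 < q" using rate_pos \<tau>_pos \<open>0 < \<delta>\<close> by (simp add: q_def)
    have "(norm (it y n - u\<^sub>d))\<^sup>2 + real n * q \<le> (norm (u\<^sub>0 - u\<^sub>d))\<^sup>2" for n
    proof (induction n)
      case (Suc n)
      have "it y n \<in> B" using iterate_in_ball[OF y res order_refl] .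
      from step_decrease[OF this y res step_size, of n]
      have "(norm (it y (Suc n) - u\<^sub>d))\<^sup>2 + rate * (norm (y - F (it y n)))\<^sup>2
          \<le> (norm (it y n - u\<^sub>d))\<^sup>2" by simp
      moreover have "q \<le> rate * (norm (y - F (it y n)))\<^sup>2"
        unfolding q_def using rate_pos \<tau>_pos \<open>0 < \<delta>\<close> less_imp_le[OF res[of n]]
        by (intro mult_left_mono power_mono) auto
      ultimately show ?case using Suc by (simp add: distrib_right del: landweber.simps)
    qed simp
    then have "real n * q \<le> (norm (u\<^sub>0 - u\<^sub>d))\<^sup>2" for n
      by (smt (verit) zero_le_power2)
    then show False
      using reals_Archimedean3[OF \<open>0 < q\<close>] by (metis not_less)
  qed
  then have "\<exists>n. norm (y - F (it y n)) \<le> \<tau> * \<delta> \<and> (\<forall>m<n. \<not> norm (y - F (it y m)) \<le> \<tau> * \<delta>)"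
    by (rule exists_least_iff[THEN iffD1])
  then show ?thesis by (auto simp: discrepancy_index_def not_le)
qed

text \<open>Moving the adjoint to the other side turns the error at \<open>v\<close> into \<open>G u (v - u\<^sub>d)\<close>, which
  the cone condition, used twice with base point \<open>u\<close>, bounds by values of \<open>F\<close> alone. This form
  survives a passage to the limit through points where \<open>G\<close> is discontinuous.\<close>

lemma increment_inner_le:
  assumes "u \<in> B" "v \<in> B" and \<omega>: "\<omega> \<in> {lam..Lam}"
  shows "\<bar>(\<omega> *\<^sub>R adjoint (blinfun_apply (G u)) r) \<bullet> (v - u\<^sub>d)\<bar>
      \<le> Lam * (1 + \<mu>) * (norm r * (norm (F u\<^sub>d - F u) + norm (F v - F u)))"
proof -
  have "blinfun_apply (G u) (v - u\<^sub>d) =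
      blinfun_apply (G u) (v - u) - blinfun_apply (G u) (u\<^sub>d - u)"
    by (simp add: blinfun.diff_right)
  then have "norm (blinfun_apply (G u) (v - u\<^sub>d))
      \<le> norm (blinfun_apply (G u) (v - u)) + norm (blinfun_apply (G u) (u\<^sub>d - u))"
    by (simp only: norm_triangle_ineq4)
  also have "\<dots> \<le> (1 + \<mu>) * (norm (F u\<^sub>d - F u) + norm (F v - F u))"
    using norm_G_increment_le[OF assms(1,2)] norm_G_increment_le[OF assms(1) center_in_ball]
    by (simp add: algebra_simps)
  finally have *: "norm (blinfun_apply (G u) (v - u\<^sub>d))
      \<le> (1 + \<mu>) * (norm (F u\<^sub>d - F u) + norm (F v - F u))" .
  have "\<bar>adjoint (blinfun_apply (G u)) r \<bullet> (v - u\<^sub>d)\<bar> = \<bar>blinfun_apply (G u) (v - u\<^sub>d) \<bullet> r\<bar>"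
    using inner_adjoint[OF blinfun.bounded_linear_right, of "G u" "v - u\<^sub>d" r]
    by (simp add: inner_commute)
  also have "\<dots> \<le> norm (blinfun_apply (G u) (v - u\<^sub>d)) * norm r" by (rule Cauchy_Schwarz_ineq2)
  also have "\<dots> \<le> ((1 + \<mu>) * (norm (F u\<^sub>d - F u) + norm (F v - F u))) * norm r"
    by (intro mult_right_mono *) simp
  finally have **: "\<bar>adjoint (blinfun_apply (G u)) r \<bullet> (v - u\<^sub>d)\<bar>
      \<le> ((1 + \<mu>) * (norm (F u\<^sub>d - F u) + norm (F v - F u))) * norm r" .
  have "\<bar>(\<omega> *\<^sub>R adjoint (blinfun_apply (G u)) r) \<bullet> (v - u\<^sub>d)\<bar>
      = \<omega> * \<bar>adjoint (blinfun_apply (G u)) r \<bullet> (v - u\<^sub>d)\<bar>"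
    using \<omega> lam_pos by (simp add: abs_mult)
  also have "\<dots> \<le> Lam * (((1 + \<mu>) * (norm (F u\<^sub>d - F u) + norm (F v - F u))) * norm r)"
    using \<omega> lam_pos ** by (intro mult_mono) auto
  finally show ?thesis by (simp add: mult_ac)
qed

text \<open>The hypothesis \<open>compact_steps\<close> is the only trace of the compactly embedded space. The
  residuals of all iterates up to stopping have a common bound, so all increments lie in one compact
  set \<open>K\<close>, and the \<open>n\<close>-th iterates lie in the compact sum of \<open>n\<close> copies of \<open>K\<close> and the starting
  point. A sequence is continued beyond its stopping index by the constant last iterate, which
  accounts for \<open>0 \<in> K\<close>.\<close>

lemma stopped_iterates_relatively_compact:
  fixes y :: "nat \<Rightarrow> 'y" and \<delta> :: "nat \<Rightarrow> real" and N :: "nat \<Rightarrow> nat"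
  assumes compact_steps: "\<And>R. \<exists>K. compact K \<and> 0 \<in> K \<and> (\<forall>u\<in>B. \<forall>r. \<forall>\<omega>\<in>{lam..Lam}.
        norm r \<le> R \<longrightarrow> \<omega> *\<^sub>R adjoint (blinfun_apply (G u)) r \<in> K)"
    and y: "\<And>k. norm (y k - F u\<^sub>d) \<le> \<delta> k" and "\<And>k. \<delta> k \<le> D"
    and N: "\<And>k. discrepancy_index F it \<tau> (\<delta> k) (y k) (N k)"
  shows "\<exists>C. compact C \<and> (\<forall>k. it (y k) (min n (N k)) \<in> C)"
proof (induction n)
  case 0
  show ?case by (intro exI[of _ "{u\<^sub>0}"]) simp
next
  case (Suc n)
  then obtain C where C: "compact C" "\<And>k. it (y k) (min n (N k)) \<in> C" by blast
  have ball: "it (y k) j \<in> B" if "j \<le> N k" for k j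
    using iterate_in_ball[OF y, of "N k" k j] N[of k] that by (auto simp: discrepancy_index_def)
  have residual: "norm (y k - F (it (y k) j)) \<le> D + L / (1 - \<mu>) * \<rho>" if "j \<le> N k" for k j
  proof -
    have "norm (y k - F (it (y k) j)) \<le> norm (y k - F u\<^sub>d) + norm (F u\<^sub>d - F (it (y k) j))"
      using norm_triangle_ineq[of "y k - F u\<^sub>d" "F u\<^sub>d - F (it (y k) j)"] by simp
    moreover have "norm (F u\<^sub>d - F (it (y k) j)) \<le> L / (1 - \<mu>) * norm (u\<^sub>d - it (y k) j)"
      by (rule F_lipschitz[OF ball[OF that] center_in_ball])
    moreover have "L / (1 - \<mu>) * norm (u\<^sub>d - it (y k) j) \<le> L / (1 - \<mu>) * \<rho>"
      using ball[OF that] L_pos \<mu>_less_1 by (intro mult_left_mono) (auto simp: dist_norm)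
    ultimately show ?thesis using y[of k] \<open>\<delta> k \<le> D\<close> by linarith
  qed
  obtain K where K: "compact K" "0 \<in> K"
    "\<And>u r \<omega>. u \<in> B \<Longrightarrow> norm r \<le> D + L / (1 - \<mu>) * \<rho> \<Longrightarrow> \<omega> \<in> {lam..Lam} \<Longrightarrow>
       \<omega> *\<^sub>R adjoint (blinfun_apply (G u)) r \<in> K"
    using compact_steps[of "D + L / (1 - \<mu>) * \<rho>"] by blast
  have "it (y k) (min (Suc n) (N k)) \<in> {a + b |a b. a \<in> C \<and> b \<in> K}" for k
  proof (cases "Suc n \<le> N k")
    case True
    then have "it (y k) n \<in> C" using C(2)[of k] by (simp add: min_def)
    moreover have "w n *\<^sub>R adjoint (blinfun_apply (G (it (y k) n))) (y k - F (it (y k) n)) \<in> K"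
      using True by (intro K(3) ball residual step_size) auto
    ultimately show ?thesis using True by (auto simp: min_def)
  next
    case False
    then have "min (Suc n) (N k) = min n (N k)" by linarith
    then have "it (y k) (min (Suc n) (N k)) = it (y k) (min n (N k)) + 0" by simp
    then show ?thesis using C(2)[of k] K(2) by blast
  qed
  with compact_sums[OF C(1) K(1)] show ?case by blast
qed

text \<open>The subsequence is chosen in two stages: first the stopping indices converge in the
  compact order \<^typ>\<open>enat\<close>, then the stopped iterates converge for each \<open>n\<close>. For \<open>n \<le> Nbar\<close>
  the stopped iterates eventually agree with the iterates themselves.\<close>

theorem asymptotically_stable_of_compact_steps:
  assumes compact_steps: "\<And>R. \<exists>K. compact K \<and> 0 \<in> K \<and> (\<forall>u\<in>B. \<forall>r. \<forall>\<omega>\<in>{lam..Lam}.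
        norm r \<le> R \<longrightarrow> \<omega> *\<^sub>R adjoint (blinfun_apply (G u)) r \<in> K)"
  shows "asymptotically_stable F u\<^sub>d \<rho> it (discrepancy_index F it \<tau>)"
  unfolding asymptotically_stable_def
proof (intro allI impI)
  fix \<delta> :: "nat \<Rightarrow> real" and y :: "nat \<Rightarrow> 'y"
  assume \<delta>_pos: "\<forall>k. 0 < \<delta> k" and \<delta>_lim: "\<delta> \<longlonglongrightarrow> 0"
    and y: "\<forall>k. norm (y k - F u\<^sub>d) \<le> \<delta> k"
  have "\<forall>k. \<exists>N. discrepancy_index F it \<tau> (\<delta> k) (y k) N"
    using discrepancy_index_exists y \<delta>_pos by blast
  then obtain N where N: "\<And>k. discrepancy_index F it \<tau> (\<delta> k) (y k) (N k)" by metis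
  have before: "\<tau> * \<delta> k < norm (y k - F (it (y k) n))" if "n < N k" for k n
    using N[of k] that by (simp add: discrepancy_index_def)
  have ball: "it (y k) n \<in> B" if "n \<le> N k" for k n
    using iterate_in_ball[of "y k" "\<delta> k" "N k" n] y before that by blast
  obtain D where D: "\<And>k. \<delta> k \<le> D"
    using Bseq_def convergent_imp_Bseq[of \<delta>] \<delta>_lim by (metis abs_le_D1 convergentI real_norm_def)
  have "\<forall>n. \<exists>C. compact C \<and> (\<forall>k. it (y k) (min n (N k)) \<in> C)"
    using stopped_iterates_relatively_compact[OF compact_steps y[rule_format] D N] by (rule allI)
  then obtain C where C: "\<And>n. compact (C n)" "\<And>k n. it (y k) (min n (N k)) \<in> C n" by metis
  obtain Nbar s1 where s1: "strict_mono (s1 :: nat \<Rightarrow> nat)"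
    and Nbar1: "((\<lambda>k. enat (N k)) \<circ> s1) \<longlonglongrightarrow> Nbar"
    using compact_complete_linorder[of "\<lambda>k. enat (N k)"] by blast
  obtain s2 ut where s2: "strict_mono (s2 :: nat \<Rightarrow> nat)"
    and ut: "\<And>n. (\<lambda>i. it (y (s1 (s2 i))) (min n (N (s1 (s2 i))))) \<longlonglongrightarrow> ut n"
    using pointwise_convergent_subsequence[of C "\<lambda>k n. it (y (s1 k)) (min n (N (s1 k)))"] C
    by metis
  define s where "s = s1 \<circ> s2"
  have s: "strict_mono s" using s1 s2 by (simp add: s_def strict_mono_o)
  have Nbar: "(\<lambda>i. enat (N (s i))) \<longlonglongrightarrow> Nbar"
    using LIMSEQ_subseq_LIMSEQ[OF Nbar1 s2] by (simp add: s_def o_def)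
  have reached: "\<forall>\<^sub>F i in sequentially. n \<le> N (s i)" if "enat n \<le> Nbar" for n
  proof (cases n)
    case (Suc m)
    then have "enat m < Nbar" using that by (metis Suc_ile_eq)
    from order_tendstoD(1)[OF Nbar this] show ?thesis
      by eventually_elim (simp add: Suc)
  qed simp
  have it_lim: "(\<lambda>i. it (y (s i)) n) \<longlonglongrightarrow> ut n" if "enat n \<le> Nbar" for n
    using ut[of n] by (rule Lim_transform_eventually)
      (use reached[OF that] in eventually_elim, simp add: s_def)
  have it_ball: "\<forall>\<^sub>F i in sequentially. it (y (s i)) n \<in> B" if "enat n \<le> Nbar" for n
    using reached[OF that] by eventually_elim (rule ball)
  have ut_ball: "ut n \<in> B" if "enat n \<le> Nbar" for n
    using Lim_in_closed_set[OF closed_cball it_ball[OF that] _ it_lim[OF that]] by simp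
  have "\<exists>u\<in>solution_set F u\<^sub>d \<rho>. ut \<longlonglongrightarrow> u" if "Nbar = \<infinity>"
  proof -
    have it_lim: "(\<lambda>i. it (y (s i)) n) \<longlonglongrightarrow> ut n" and ut_ball: "ut n \<in> B"
      and it_ball: "\<forall>\<^sub>F i in sequentially. it (y (s i)) n \<in> B"
      and active: "\<forall>\<^sub>F i in sequentially. n < N (s i)" for n
      using it_lim[of n] ut_ball[of n] it_ball[of n] reached[of "Suc n"] that by (simp_all add: Suc_le_eq)
    have F_lim: "(\<lambda>i. F (it (y (s i)) n)) \<longlonglongrightarrow> F (ut n)" for n
      by (rule continuous_on_tendsto_compose[OF continuous_on_F it_lim ut_ball it_ball])
    have "(\<lambda>i. y (s i) - F u\<^sub>d) \<longlonglongrightarrow> 0"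
      by (rule Lim_null_comparison[OF _ LIMSEQ_subseq_LIMSEQ[OF \<delta>_lim s]]) (simp add: y)
    then have y_lim: "(\<lambda>i. y (s i)) \<longlonglongrightarrow> F u\<^sub>d" by (simp add: LIM_zero_iff)
    define r where "r n = norm (F u\<^sub>d - F (ut n))" for n
    have decrease: "(norm (ut (Suc n) - u\<^sub>d))\<^sup>2 + rate * (r n)\<^sup>2 \<le> (norm (ut n - u\<^sub>d))\<^sup>2" for n
      unfolding r_def
    proof (rule tendsto_le[OF trivial_limit_sequentially])
      show "(\<lambda>i. (norm (it (y (s i)) n - u\<^sub>d))\<^sup>2) \<longlonglongrightarrow> (norm (ut n - u\<^sub>d))\<^sup>2"
        by (intro tendsto_intros it_lim)
      show "(\<lambda>i. (norm (it (y (s i)) (Suc n) - u\<^sub>d))\<^sup>2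
            + rate * (norm (y (s i) - F (it (y (s i)) n)))\<^sup>2)
          \<longlonglongrightarrow> (norm (ut (Suc n) - u\<^sub>d))\<^sup>2 + rate * (norm (F u\<^sub>d - F (ut n)))\<^sup>2"
        by (intro tendsto_intros it_lim F_lim y_lim)
      show "\<forall>\<^sub>F i in sequentially. (norm (it (y (s i)) (Suc n) - u\<^sub>d))\<^sup>2
            + rate * (norm (y (s i) - F (it (y (s i)) n)))\<^sup>2 \<le> (norm (it (y (s i)) n - u\<^sub>d))\<^sup>2"
        using active[of n]
      proof eventually_elim
        case (elim i)
        show ?case
          using step_decrease[OF ball[OF less_imp_le[OF elim]] y[rule_format] before[OF elim]
              step_size, of n] by simp
      qed
    qed
    have orth: "\<bar>(ut (Suc j) - ut j) \<bullet> (ut k - u\<^sub>d)\<bar>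
        \<le> Lam * (1 + \<mu>) * (r j * (r j + norm (F (ut k) - F (ut j))))" for j k
      unfolding r_def
    proof (rule tendsto_le[OF trivial_limit_sequentially])
      show "(\<lambda>i. \<bar>(it (y (s i)) (Suc j) - it (y (s i)) j) \<bullet> (it (y (s i)) k - u\<^sub>d)\<bar>)
          \<longlonglongrightarrow> \<bar>(ut (Suc j) - ut j) \<bullet> (ut k - u\<^sub>d)\<bar>"
        by (intro tendsto_intros it_lim)
      show "(\<lambda>i. Lam * (1 + \<mu>) * (norm (y (s i) - F (it (y (s i)) j)) *
            (norm (F u\<^sub>d - F (it (y (s i)) j)) + norm (F (it (y (s i)) k) - F (it (y (s i)) j)))))
          \<longlonglongrightarrow> Lam * (1 + \<mu>) * (norm (F u\<^sub>d - F (ut j)) *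
            (norm (F u\<^sub>d - F (ut j)) + norm (F (ut k) - F (ut j))))"
        by (intro tendsto_intros it_lim F_lim y_lim)
      show "\<forall>\<^sub>F i in sequentially.
          \<bar>(it (y (s i)) (Suc j) - it (y (s i)) j) \<bullet> (it (y (s i)) k - u\<^sub>d)\<bar>
          \<le> Lam * (1 + \<mu>) * (norm (y (s i) - F (it (y (s i)) j)) *
            (norm (F u\<^sub>d - F (it (y (s i)) j)) + norm (F (it (y (s i)) k) - F (it (y (s i)) j))))"
        using it_ball[of j] it_ball[of k]
      proof eventually_elim
        case (elim i)
        have "it (y (s i)) (Suc j) - it (y (s i)) j = w j *\<^sub>R adjoint
            (blinfun_apply (G (it (y (s i)) j))) (y (s i) - F (it (y (s i)) j))" by simp
        then show ?case using increment_inner_le[OF elim step_size] by (simp only:)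
      qed
    qed
    have almost_orthogonal: "\<bar>(ut (Suc j) - ut j) \<bullet> (ut k - u\<^sub>d)\<bar>
        \<le> (2 * (Lam * (1 + \<mu>))) * (r j * (r j + r k))" for j k
    proof -
      have "norm (F (ut k) - F (ut j)) \<le> r j + r k"
        using norm_triangle_ineq4[of "F u\<^sub>d - F (ut j)" "F u\<^sub>d - F (ut k)"] by (simp add: r_def)
      moreover have "0 \<le> r j" "0 \<le> r k" by (simp_all add: r_def)
      ultimately have "r j * (r j + norm (F (ut k) - F (ut j))) \<le> r j * (2 * (r j + r k))"
        by (intro mult_left_mono) auto
      then have "Lam * (1 + \<mu>) * (r j * (r j + norm (F (ut k) - F (ut j))))
          \<le> Lam * (1 + \<mu>) * (r j * (2 * (r j + r k)))"
        by (rule mult_left_mono) (use Lam_pos \<mu>_nonneg in simp)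
      also have "\<dots> = (2 * (Lam * (1 + \<mu>))) * (r j * (r j + r k))" by (simp only: mult_ac)
      finally show ?thesis using orth[of j k] by linarith
    qed
    have "convergent ut"
    proof (rule convergent_of_monotone_decrease[where p = u\<^sub>d and c = rate and r = r])
      show "0 < rate" by (rule rate_pos)
      show "0 \<le> 2 * (Lam * (1 + \<mu>))" using Lam_pos \<mu>_nonneg by simp
    qed (rule decrease almost_orthogonal | simp add: r_def)+
    then obtain u where u: "ut \<longlonglongrightarrow> u" by (auto simp: convergent_def)
    have "u \<in> B" using Lim_in_closed_set[OF closed_cball _ _ u] ut_ball by simp
    (* The squared errors converge, so their decrements, and with them the residuals, vanish. *)
    have "(\<lambda>n. ((norm (ut n - u\<^sub>d))\<^sup>2 - (norm (ut (Suc n) - u\<^sub>d))\<^sup>2) / rate)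
        \<longlonglongrightarrow> ((norm (u - u\<^sub>d))\<^sup>2 - (norm (u - u\<^sub>d))\<^sup>2) / rate"
      using rate_pos by (intro tendsto_intros u LIMSEQ_Suc) auto
    moreover have "\<forall>\<^sub>F n in sequentially. norm ((r n)\<^sup>2)
        \<le> ((norm (ut n - u\<^sub>d))\<^sup>2 - (norm (ut (Suc n) - u\<^sub>d))\<^sup>2) / rate"
      using decrease rate_pos by (auto simp: field_simps intro!: always_eventually)
    ultimately have "(\<lambda>n. (r n)\<^sup>2) \<longlonglongrightarrow> 0"
      using Lim_null_comparison[of "\<lambda>n. (r n)\<^sup>2"] by simp
    then have "r \<longlonglongrightarrow> 0" by (simp add: tendsto_null_power)
    moreover have "r \<longlonglongrightarrow> norm (F u\<^sub>d - F u)"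
      unfolding r_def
      by (intro tendsto_intros continuous_on_tendsto_compose[OF continuous_on_F u \<open>u \<in> B\<close>])
        (intro always_eventually allI ut_ball)
    ultimately have "F u = F u\<^sub>d" using LIMSEQ_unique by fastforce
    with u \<open>u \<in> B\<close> show ?thesis by (auto simp: solution_set_def)
  qed
  with N s Nbar it_lim ut_ball
  show "\<exists>N. (\<forall>k. discrepancy_index F it \<tau> (\<delta> k) (y k) (N k)) \<and>
      (\<exists>s Nbar ut. strict_mono s \<and> (\<lambda>i. enat (N (s i))) \<longlonglongrightarrow> Nbar \<and>
        (\<forall>n. enat n \<le> Nbar \<longrightarrow> ut n \<in> B \<and> (\<lambda>i. it (y (s i)) n) \<longlonglongrightarrow> ut n) \<and>
        (Nbar = \<infinity> \<longrightarrow> (\<exists>u\<in>solution_set F u\<^sub>d \<rho>. ut \<longlonglongrightarrow> u)))"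
    by blast
qed

end

section \<open>Compactly embedded ranges\<close>

theorem corollary2p9:
  fixes F :: "'u::{real_inner, complete_space} \<Rightarrow> 'y::{real_inner, complete_space}"
    and G :: "'u \<Rightarrow> 'u \<Rightarrow>\<^sub>L 'y"
    and \<iota> :: "'z::banach \<Rightarrow> 'u"
    and u\<^sub>d u\<^sub>0 :: 'u
    and w :: "nat \<Rightarrow> real"
    and L L' \<rho>\<^sub>0 \<rho> \<mu> \<tau> lam Lam :: real
  assumes "completely_continuous F"
    and "L > 0" and "\<rho>\<^sub>0 > 0"
    and "\<forall>u \<in> cball u\<^sub>d \<rho>\<^sub>0. norm (G u) \<le> L"
    and "0 < \<rho>" and "\<rho> \<le> \<rho>\<^sub>0"
    and "0 \<le> \<mu>" and "\<mu> < 1"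
    and "\<forall>u \<in> cball u\<^sub>d \<rho>. \<forall>v \<in> cball u\<^sub>d \<rho>.
           norm (F v - F u - blinfun_apply (G u) (v - u)) \<le> \<mu> * norm (F v - F u)"
    and "compact_embedding \<iota>"
    and "(\<Union>u. range (adjoint (blinfun_apply (G u)))) \<subseteq> range \<iota>"
    and "L' > 0"
    and "\<forall>u \<in> cball u\<^sub>d \<rho>. bounded_linear (inv \<iota> \<circ> adjoint (blinfun_apply (G u))) \<and>
           onorm (inv \<iota> \<circ> adjoint (blinfun_apply (G u))) \<le> L'"
    and "\<tau> > 1" and "0 < lam" and "lam \<le> Lam"
    and "2 * (\<mu> + 1) / \<tau> - (2 - 2 * \<mu> - Lam * L\<^sup>2) < 0"
    and "- 1 + \<mu> + 5 * Lam * L\<^sup>2 < 0"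
    and "u\<^sub>0 \<in> cball u\<^sub>d \<rho>"
    and "\<forall>n. w n \<in> {lam..Lam}"
  shows "asymptotically_stable F u\<^sub>d \<rho> (landweber F G w u\<^sub>0)
           (discrepancy_index F (landweber F G w u\<^sub>0) \<tau>)"
proof -
  interpret landweber_setting F G u\<^sub>d u\<^sub>0 w L \<rho> \<mu> \<tau> lam Lam
    using assms by unfold_locales auto
  have "\<exists>K. compact K \<and> 0 \<in> K \<and> (\<forall>u\<in>B. \<forall>r. \<forall>\<omega>\<in>{lam..Lam}.
        norm r \<le> R \<longrightarrow> \<omega> *\<^sub>R adjoint (blinfun_apply (G u)) r \<in> K)" for R
  proof -
    interpret \<iota>: bounded_linear \<iota>
      using assms(10) by (simp add: compact_embedding_def)
    define S where "S = cball (0 :: 'z) (Lam * (L' * \<bar>R\<bar>))"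
    have "0 \<in> S" using Lam_pos assms(12) by (simp add: S_def)
    then have "\<iota> 0 \<in> \<iota> ` S" by (rule imageI)
    have "\<omega> *\<^sub>R adjoint (blinfun_apply (G u)) r \<in> \<iota> ` S"
      if "u \<in> B" "\<omega> \<in> {lam..Lam}" "norm r \<le> R" for u r \<omega>
    proof -
      define z where "z = inv \<iota> (adjoint (blinfun_apply (G u)) r)"
      have "adjoint (blinfun_apply (G u)) r \<in> range \<iota>" using assms(11) by blast
      then have z: "\<iota> z = adjoint (blinfun_apply (G u)) r"
        unfolding z_def by (rule f_inv_into_f)
      have "bounded_linear (inv \<iota> \<circ> adjoint (blinfun_apply (G u)))"
        and op: "onorm (inv \<iota> \<circ> adjoint (blinfun_apply (G u))) \<le> L'"
        using assms(13) that(1) by auto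
      from onorm[OF this(1), of r]
      have "norm z \<le> onorm (inv \<iota> \<circ> adjoint (blinfun_apply (G u))) * norm r" by (simp add: z_def)
      also have "\<dots> \<le> L' * \<bar>R\<bar>" using op that(3) assms(12) by (intro mult_mono) auto
      finally have "norm (\<omega> *\<^sub>R z) \<le> Lam * (L' * \<bar>R\<bar>)"
        using that(2) lam_pos by (auto intro!: mult_mono)
      then have "\<omega> *\<^sub>R z \<in> S" by (simp add: S_def)
      moreover have "\<omega> *\<^sub>R adjoint (blinfun_apply (G u)) r = \<iota> (\<omega> *\<^sub>R z)"
        by (simp add: z \<iota>.scaleR)
      ultimately show ?thesis by blast
    qed
    moreover have "compact (closure (\<iota> ` S))"
      using assms(10) by (simp add: compact_embedding_def S_def)
    ultimately show ?thesis
      using closure_subset[of "\<iota> ` S"] \<open>\<iota> 0 \<in> \<iota> ` S\<close> \<iota>.zero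
      by (intro exI[of _ "closure (\<iota> ` S)"]) auto
  qed
  then show ?thesis by (rule asymptotically_stable_of_compact_steps)
qed

end
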